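(* Let $p\in[1,\infty]$, let $E$ and $L$ be locally convex spaces, and let $T:E\to L$ be an operator. (i) If $T^\ast(B)$ is a $p$-$(V)$ set in $E'$ for every bounded subset $B$ of $L'_\beta$, then $T$ is $p$-convergent. The converse assertion is true if $L$ is quasibarrelled. (ii) If $T^\ast(B)$ is a $p$-$(V)$ set in $E'$ for every bounded subset $B$ of $L'_{w^\ast}$, then $T$ is $p$-convergent. The converse assertion is true if $L$ is barrelled.
   Context: All locally convex spaces are Hausdorff, over $\mathbb{F}\in\{\mathbb{R},\mathbb{C}\}$. An operator is a continuous linear map; $T^\ast:L'\to E'$ is its adjoint. $L'_\beta$ and $L'_{w^\ast}$ denote the dual $L'$ with the strong topology $\beta(L',L)$ and the weak$^\ast$ topology $\sigma(L',L)$, respectively. $L$ is barrelled (resp. quasibarrelled) if every $\sigma(L',L)$-bounded (resp. $\beta(L',L)$-bounded) subset of $L'$ is equicontinuous. A sequence $\{x_n\}_{n\in\omega}$ in $E$ is weakly $p$-summable if $(\langle\chi,x_n\rangle)_n\in\ell_p$ (or $\in c_0$ if $p=\infty$) for every $\chi\in E'$. A non-empty $B\subseteq E'$ is a $p$-$(V)$ set if $\lim_{n}\sup_{\chi\in B}|\langle\chi,x_n\rangle|=0$ for every weakly $p$-summable sequence $\{x_n\}$ in $E$. A linear map is $p$-convergent if it sends weakly $p$-summable sequences to null sequences. The sets $B$ in the statement are non-empty. *)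

theory Defs
  imports "HOL-Analysis.Analysis" "HOL-Library.Function_Algebras"
begin

text \<open>
  The scalar field, one of \<open>\<real>\<close> and \<open>\<complex>\<close>. The axiom determines the field together with its norm:
  it is \<open>\<real>\<close>, or it is \<open>\<real> + \<real>i\<close> with \<open>i\<^sup>2 = -1\<close> and the usual modulus.
\<close>

class real_or_complex = real_normed_field +
  assumes real_or_complex:
    "(\<forall>z. \<exists>a. z = a *\<^sub>R 1) \<or>
     (\<exists>i. i * i = - 1 \<and>
       (\<forall>z. \<exists>a b. z = a *\<^sub>R 1 + b *\<^sub>R i \<and> norm z = sqrt (a\<^sup>2 + b\<^sup>2)))"

instance real :: real_or_complex
  by standard auto

instance complex :: real_or_complex
proof
  have "\<exists>a b. z = a *\<^sub>R 1 + b *\<^sub>R \<i> \<and> norm z = sqrt (a\<^sup>2 + b\<^sup>2)" for z :: complex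
    by (rule exI[of _ "Re z"], rule exI[of _ "Im z"]) (simp add: complex_eq_iff cmod_def)
  moreover have "\<i> * \<i> = (- 1 :: complex)" by simp
  ultimately show "(\<forall>z :: complex. \<exists>a. z = a *\<^sub>R 1) \<or>
     (\<exists>i :: complex. i * i = - 1 \<and>
       (\<forall>z. \<exists>a b. z = a *\<^sub>R 1 + b *\<^sub>R i \<and> norm z = sqrt (a\<^sup>2 + b\<^sup>2)))"
    by blast
qed

text \<open>
  Hausdorff locally convex spaces over the scalar field \<open>'k\<close>. The underlying real vector space
  structure of the type is the restriction of \<open>scale\<close> to real scalars, so that \<^const>\<open>convex\<close>
  is available.
\<close>

locale locally_convex_space = vector_space scale
  for scale :: "'k::real_or_complex \<Rightarrow> 'a \<Rightarrow> 'a::{real_vector, topological_ab_group_add, t2_space}" +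
  assumes scale_of_real: "scale (of_real r) x = r *\<^sub>R x"
    and continuous_scale: "continuous_on UNIV (\<lambda>(c, x). scale c x)"
    and locally_convex:
      "\<lbrakk>open (U :: 'a set); 0 \<in> U\<rbrakk> \<Longrightarrow> \<exists>C. open C \<and> convex C \<and> 0 \<in> C \<and> C \<subseteq> U"

definition operator ::
  "('k::field \<Rightarrow> 'a \<Rightarrow> 'a) \<Rightarrow> ('k \<Rightarrow> 'b \<Rightarrow> 'b)
    \<Rightarrow> ('a::{ab_group_add, topological_space} \<Rightarrow> 'b::{ab_group_add, topological_space}) \<Rightarrow> bool"
  where "operator sE sL T \<longleftrightarrow> Vector_Spaces.linear sE sL T \<and> continuous_on UNIV T"

definition dual ::
  "('k::real_normed_field \<Rightarrow> 'a \<Rightarrow> 'a) \<Rightarrow> ('a::{ab_group_add, topological_space} \<Rightarrow> 'k) set"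
  where "dual s = {f. operator s (*) f}"

definition dual_scale :: "'k::times \<Rightarrow> ('a \<Rightarrow> 'k) \<Rightarrow> ('a \<Rightarrow> 'k)"
  where "dual_scale c f = (\<lambda>x. c * f x)"

definition adjoint_op :: "('a \<Rightarrow> 'b) \<Rightarrow> ('b \<Rightarrow> 'k) \<Rightarrow> ('a \<Rightarrow> 'k)"
  where "adjoint_op T f = f \<circ> T"

text \<open>
  Bounded subsets of a topological vector space. The topology is an explicit argument because
  the dual carries several; for the topology of a type take \<^const>\<open>euclidean\<close>, which is the
  topology of an arbitrary type of class \<^class>\<open>topological_space\<close>.
\<close>

definition tvs_bounded ::
  "('k::real_normed_field \<Rightarrow> 'v \<Rightarrow> 'v) \<Rightarrow> 'v::zero topology \<Rightarrow> 'v set \<Rightarrow> bool"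
  where "tvs_bounded s X B \<longleftrightarrow>
    B \<subseteq> topspace X \<and>
    (\<forall>U. openin X U \<and> 0 \<in> U \<longrightarrow> (\<exists>r>0. \<forall>c. r \<le> norm c \<longrightarrow> B \<subseteq> s c ` U))"

text \<open>The weak* topology is the topology of pointwise convergence on the dual.\<close>

definition weak_star ::
  "('k::real_normed_field \<Rightarrow> 'a \<Rightarrow> 'a)
    \<Rightarrow> ('a::{ab_group_add, topological_space} \<Rightarrow> 'k) topology"
  where "weak_star s = subtopology (product_topology (\<lambda>_. euclidean) UNIV) (dual s)"

text \<open>
  The strong topology is the topology of uniform convergence on bounded sets. The sets
  \<open>{g \<in> dual s. \<forall>x\<in>A. norm (g x - f x) < e}\<close> with \<open>A\<close> bounded and \<open>e > 0\<close> form a base of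
  neighbourhoods of \<open>f\<close>, but are not open in general.
\<close>

definition strong_open ::
  "('k::real_normed_field \<Rightarrow> 'a \<Rightarrow> 'a)
    \<Rightarrow> ('a::{ab_group_add, topological_space} \<Rightarrow> 'k) set \<Rightarrow> bool"
  where "strong_open s U \<longleftrightarrow>
    U \<subseteq> dual s \<and>
    (\<forall>f\<in>U. \<exists>A e. tvs_bounded s euclidean A \<and> e > 0 \<and>
      {g \<in> dual s. \<forall>x\<in>A. norm (g x - f x) < e} \<subseteq> U)"

definition strong_topology ::
  "('k::real_normed_field \<Rightarrow> 'a \<Rightarrow> 'a)
    \<Rightarrow> ('a::{ab_group_add, topological_space} \<Rightarrow> 'k) topology"
  where "strong_topology s = topology (strong_open s)"

lemma tvs_bounded_Un:
  assumes "tvs_bounded s X A" "tvs_bounded s X B"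
  shows "tvs_bounded s X (A \<union> B)"
  unfolding tvs_bounded_def
proof (intro conjI allI impI)
  show "A \<union> B \<subseteq> topspace X"
    using assms by (auto simp: tvs_bounded_def)
next
  fix U assume U: "openin X U \<and> 0 \<in> U"
  obtain r1 where r1: "r1 > 0" "\<And>c. r1 \<le> norm c \<Longrightarrow> A \<subseteq> s c ` U"
    using assms(1) U unfolding tvs_bounded_def by blast
  obtain r2 where r2: "r2 > 0" "\<And>c. r2 \<le> norm c \<Longrightarrow> B \<subseteq> s c ` U"
    using assms(2) U unfolding tvs_bounded_def by blast
  have "A \<union> B \<subseteq> s c ` U" if "max r1 r2 \<le> norm c" for c
    using r1(2)[of c] r2(2)[of c] that by simp
  then show "\<exists>r>0. \<forall>c. r \<le> norm c \<longrightarrow> A \<union> B \<subseteq> s c ` U"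
    using r1(1) by (intro exI[of _ "max r1 r2"]) simp
qed

lemma istopology_strong_open: "istopology (strong_open s)"
  unfolding istopology_def
proof (intro conjI allI impI)
  fix S T assume S: "strong_open s S" and T: "strong_open s T"
  show "strong_open s (S \<inter> T)"
    unfolding strong_open_def
  proof (intro conjI ballI)
    show "S \<inter> T \<subseteq> dual s" using S by (auto simp: strong_open_def)
  next
    fix f assume f: "f \<in> S \<inter> T"
    obtain A d where A: "tvs_bounded s euclidean A" "d > 0"
      "{g \<in> dual s. \<forall>x\<in>A. norm (g x - f x) < d} \<subseteq> S"
      using S f unfolding strong_open_def by blast
    obtain B e where B: "tvs_bounded s euclidean B" "e > 0"
      "{g \<in> dual s. \<forall>x\<in>B. norm (g x - f x) < e} \<subseteq> T"
      using T f unfolding strong_open_def by blast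
    have "{g \<in> dual s. \<forall>x\<in>A \<union> B. norm (g x - f x) < min d e} \<subseteq> S \<inter> T"
      using A(3) B(3) by auto
    with tvs_bounded_Un[OF A(1) B(1)] A(2) B(2)
    show "\<exists>A e. tvs_bounded s euclidean A \<and> e > 0 \<and>
        {g \<in> dual s. \<forall>x\<in>A. norm (g x - f x) < e} \<subseteq> S \<inter> T"
      by (intro exI[of _ "A \<union> B"] exI[of _ "min d e"]) simp
  qed
next
  fix \<K> assume K: "\<forall>K\<in>\<K>. strong_open s K"
  show "strong_open s (\<Union>\<K>)"
    unfolding strong_open_def
  proof (intro conjI ballI)
    show "\<Union>\<K> \<subseteq> dual s" using K by (auto simp: strong_open_def)
  next
    fix f assume "f \<in> \<Union>\<K>"
    then obtain K where "K \<in> \<K>" "f \<in> K" by blast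
    moreover from this K obtain A e where "tvs_bounded s euclidean A" "e > 0"
      "{g \<in> dual s. \<forall>x\<in>A. norm (g x - f x) < e} \<subseteq> K"
      unfolding strong_open_def by blast
    ultimately show "\<exists>A e. tvs_bounded s euclidean A \<and> e > 0 \<and>
        {g \<in> dual s. \<forall>x\<in>A. norm (g x - f x) < e} \<subseteq> \<Union>\<K>"
      by blast
  qed
qed

lemma openin_strong_topology: "openin (strong_topology s) = strong_open s"
  by (simp add: strong_topology_def istopology_strong_open)

lemma topspace_strong_topology: "topspace (strong_topology s) = dual s"
proof
  show "topspace (strong_topology s) \<subseteq> dual s"
    using openin_topspace[of "strong_topology s"]
    by (simp add: openin_strong_topology strong_open_def)
next
  have "tvs_bounded s euclidean {}" by (auto simp: tvs_bounded_def intro: exI[of _ 1])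
  then have "strong_open s (dual s)"
    unfolding strong_open_def by (blast intro: zero_less_one)
  then show "dual s \<subseteq> topspace (strong_topology s)"
    by (simp add: openin_subset openin_strong_topology)
qed

lemma topspace_weak_star: "topspace (weak_star s) = dual s"
  by (simp add: weak_star_def)

definition equicontinuous :: "('a::topological_space \<Rightarrow> 'k::real_normed_vector) set \<Rightarrow> bool"
  where "equicontinuous B \<longleftrightarrow>
    (\<forall>x. \<forall>e>0. \<exists>U. open U \<and> x \<in> U \<and> (\<forall>f\<in>B. \<forall>y\<in>U. norm (f y - f x) < e))"

definition barrelled ::
  "('k::real_normed_field \<Rightarrow> 'a \<Rightarrow> 'a::{ab_group_add, topological_space}) \<Rightarrow> bool"
  where "barrelled s \<longleftrightarrow> (\<forall>B. tvs_bounded dual_scale (weak_star s) B \<longrightarrow> equicontinuous B)"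

definition quasibarrelled ::
  "('k::real_normed_field \<Rightarrow> 'a \<Rightarrow> 'a::{ab_group_add, topological_space}) \<Rightarrow> bool"
  where "quasibarrelled s \<longleftrightarrow>
    (\<forall>B. tvs_bounded dual_scale (strong_topology s) B \<longrightarrow> equicontinuous B)"

definition weakly_summable ::
  "ennreal \<Rightarrow> ('k::real_normed_field \<Rightarrow> 'a \<Rightarrow> 'a)
    \<Rightarrow> (nat \<Rightarrow> 'a::{ab_group_add, topological_space}) \<Rightarrow> bool"
  where "weakly_summable p s x \<longleftrightarrow>
    (\<forall>f\<in>dual s.
      if p = \<infinity> then (\<lambda>n. f (x n)) \<longlonglongrightarrow> 0
      else summable (\<lambda>n. norm (f (x n)) powr enn2real p))"

text \<open>The supremum is taken in \<open>[0, \<infinity>]\<close>, since it need not be finite for every \<open>n\<close>.\<close>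

definition V_set ::
  "ennreal \<Rightarrow> ('k::real_normed_field \<Rightarrow> 'a \<Rightarrow> 'a)
    \<Rightarrow> ('a::{ab_group_add, topological_space} \<Rightarrow> 'k) set \<Rightarrow> bool"
  where "V_set p s B \<longleftrightarrow>
    B \<noteq> {} \<and> B \<subseteq> dual s \<and>
    (\<forall>x. weakly_summable p s x \<longrightarrow> (\<lambda>n. SUP f\<in>B. ennreal (norm (f (x n)))) \<longlonglongrightarrow> 0)"

definition p_convergent ::
  "ennreal \<Rightarrow> ('k::real_normed_field \<Rightarrow> 'a \<Rightarrow> 'a)
    \<Rightarrow> ('a::{ab_group_add, topological_space} \<Rightarrow> 'b::{zero, topological_space}) \<Rightarrow> bool"
  where "p_convergent p s T \<longleftrightarrow> (\<forall>x. weakly_summable p s x \<longrightarrow> (\<lambda>n. T (x n)) \<longlonglongrightarrow> 0)"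

end

theory Submission
  imports Defs
begin

text \<open>
  If \<open>T\<close> is \<open>p\<close>-convergent and \<open>B\<close> is equicontinuous, the members of \<open>B\<close> are uniformly small on
  a neighbourhood of \<open>0\<close> in \<open>L\<close>, and \<open>T x\<^sub>n\<close> eventually lies in it; so \<open>T\<^sup>*(B)\<close> is a \<open>p\<close>-\<open>(V)\<close> set
  (\<open>V_set_adjoint_of_equicontinuous\<close>). Quasibarrelledness and barrelledness are precisely what makes
  every strongly, respectively weak*, bounded set equicontinuous.

  For the other direction, let \<open>W\<close> be a neighbourhood of \<open>0\<close> in \<open>L\<close>. The polar of a small enough
  neighbourhood \<open>U\<close> of \<open>0\<close> is strongly bounded (\<open>strongly_bounded_polar\<close>), and by Hahn--Banach it
  contains, for each \<open>y \<notin> W\<close>, a functional of modulus at least \<open>1\<close> at \<open>y\<close>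
  (\<open>polar_separates\<close>). The adjoint images of these functionals tend to \<open>0\<close> uniformly along any
  weakly \<open>p\<close>-summable sequence \<open>x\<^sub>n\<close>, so \<open>T x\<^sub>n\<close> is eventually in \<open>W\<close>.
  The strong topology is finer than the weak* topology, hence strongly bounded sets are weak*
  bounded, and the weak* hypothesis of (ii) implies the strong hypothesis of (i).

  The Hahn--Banach theorem is obtained from sublinear functionals: a minimal sublinear functional
  is linear, and minimal ones exist below any given one by Zorn's lemma. Complex functionals are
  recovered from their real parts.
\<close>

section \<open>Sublinear functionals and the Hahn--Banach theorem\<close>

definition sublinear :: "('a::real_vector \<Rightarrow> real) \<Rightarrow> bool"
  where "sublinear q \<longleftrightarrow> (\<forall>x y. q (x + y) \<le> q x + q y) \<and> (\<forall>t\<ge>0. \<forall>x. q (t *\<^sub>R x) = t * q x)"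

lemma sublinear_add: "sublinear q \<Longrightarrow> q (x + y) \<le> q x + q y"
  and sublinear_scaleR: "sublinear q \<Longrightarrow> t \<ge> 0 \<Longrightarrow> q (t *\<^sub>R x) = t * q x"
  by (auto simp: sublinear_def)

lemma sublinear_0: "sublinear q \<Longrightarrow> q 0 = 0"
  using sublinear_scaleR[of q 0 0] by simp

lemma sublinear_minus_ge: "sublinear q \<Longrightarrow> - q (- x) \<le> q x"
  using sublinear_add[of q x "- x"] sublinear_0[of q] by simp

text \<open>One inequality suffices for homogeneity, since it also applies to the inverse factor.\<close>

lemma sublinearI:
  assumes add: "\<And>x y. q (x + y) \<le> q x + q y"
    and zero: "q 0 = 0"
    and scale: "\<And>t x. t > 0 \<Longrightarrow> q (t *\<^sub>R x) \<le> t * q x"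
  shows "sublinear q"
  unfolding sublinear_def
proof (intro conjI allI impI)
  fix t :: real and x assume "t \<ge> 0"
  show "q (t *\<^sub>R x) = t * q x"
  proof (cases "t = 0")
    case False
    with \<open>t \<ge> 0\<close> have t: "t > 0" by simp
    have "q x = q (inverse t *\<^sub>R (t *\<^sub>R x))" using t by simp
    also have "\<dots> \<le> inverse t * q (t *\<^sub>R x)" using t by (intro scale) simp
    finally have "t * q x \<le> q (t *\<^sub>R x)" using t by (simp add: field_simps)
    with scale[OF t] show ?thesis by (simp add: order_antisym)
  qed (simp add: zero)
qed (rule add)

text \<open>
  A sublinear functional can be decreased until it is linear along the line through \<open>y\<close>: the
  infimum of \<open>q (x + t y) - t q y\<close> over \<open>t \<ge> 0\<close> is again sublinear, and at \<open>- y\<close>, where \<open>t = 1\<close>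
  is available, it is at most \<open>- q y\<close>. The argument below uses this twice: to reach a prescribed
  value at a point, and to see that minimal sublinear functionals are odd.
\<close>

lemma sublinear_decrease:
  assumes q: "sublinear q"
  obtains r where "sublinear r" "r \<le> q" "r (- y) \<le> - q y"
proof
  define h where "h x t = q (x + t *\<^sub>R y) - t * q y" for x t
  define r where "r x = (INF t\<in>{0..}. h x t)" for x
  have low: "- q (- x) \<le> h x t" if "t \<ge> 0" for x t
  proof -
    have "q (t *\<^sub>R y) \<le> q (x + t *\<^sub>R y) + q (- x)"
      using sublinear_add[OF q, of "x + t *\<^sub>R y" "- x"] by simp
    then show ?thesis using sublinear_scaleR[OF q that, of y] by (simp add: h_def)
  qed
  have bdd: "bdd_below (h x ` {0..})" for x
    by (rule bdd_belowI2[of _ "- q (- x)"]) (simp add: low)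
  have le: "r x \<le> h x t" if "t \<ge> 0" for x t
    unfolding r_def using that by (intro cINF_lower bdd) simp
  have ge: "m \<le> r x" if "\<And>t. t \<ge> 0 \<Longrightarrow> m \<le> h x t" for m x
    unfolding r_def using that by (intro cINF_greatest) auto
  show "r \<le> q"
    using le[of 0] by (auto simp: le_fun_def h_def)
  show "r (- y) \<le> - q y"
    using le[of 1 "- y"] sublinear_0[OF q] by (simp add: h_def)
  show "sublinear r"
  proof (rule sublinearI)
    fix a b
    have "r (a + b) - h a s \<le> h b t" if "s \<ge> 0" "t \<ge> 0" for s t
    proof -
      have "r (a + b) \<le> h (a + b) (s + t)" using that by (intro le) simp
      also have "\<dots> \<le> h a s + h b t"
        using sublinear_add[OF q, of "a + s *\<^sub>R y" "b + t *\<^sub>R y"]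
        by (simp add: h_def algebra_simps)
      finally show ?thesis by simp
    qed
    then have "r (a + b) - r b \<le> h a s" if "s \<ge> 0" for s
      using ge[of "r (a + b) - h a s" b] that by fastforce
    then show "r (a + b) \<le> r a + r b"
      using ge[of "r (a + b) - r b" a] by fastforce
  next
    show "r 0 = 0"
      using le[of 0 0] ge[of 0 0] low[of _ 0] sublinear_0[OF q]
      by (intro order_antisym) (auto simp: h_def)
  next
    fix t :: real and x assume t: "t > 0"
    have "r (t *\<^sub>R x) / t \<le> h x s" if "s \<ge> 0" for s
    proof -
      have "r (t *\<^sub>R x) \<le> h (t *\<^sub>R x) (t * s)" using t that by (intro le) simp
      also have "\<dots> = t * h x s"
        using sublinear_scaleR[OF q, of t "x + s *\<^sub>R y"] t by (simp add: h_def algebra_simps)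
      finally show ?thesis using t by (simp add: field_simps)
    qed
    then have "r (t *\<^sub>R x) / t \<le> r x" by (rule ge)
    then show "r (t *\<^sub>R x) \<le> t * r x" using t by (simp add: field_simps)
  qed
qed

text \<open>
  Zorn's lemma applies because everything sublinear below \<open>q\<close> is bounded below by \<open>- q (- x)\<close>, so
  chains have pointwise infima; comparability within the chain makes the infimum subadditive.
\<close>

lemma minimal_sublinear_exists:
  assumes q: "sublinear q"
  obtains r where "sublinear r" "r \<le> q" "\<And>s. sublinear s \<Longrightarrow> s \<le> r \<Longrightarrow> s = r"
proof -
  define A where "A = {r. sublinear r \<and> r \<le> q}"
  define P where "P r s \<longleftrightarrow> s \<le> r" for r s :: "'a \<Rightarrow> real"
  have "\<exists>m\<in>A. \<forall>a\<in>A. P m a \<longrightarrow> a = m"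
  proof (rule predicate_Zorn)
    show "partial_order_on A (relation_of P A)"
      by (rule partial_order_on_relation_ofI) (auto simp: P_def)
  next
    fix C assume C: "C \<in> Chains (relation_of P A)"
    then have CA: "C \<subseteq> A" by (auto simp: Chains_def relation_of_def)
    have chain: "r \<le> s \<or> s \<le> r" if "r \<in> C" "s \<in> C" for r s
      using C that by (auto simp: Chains_def relation_of_def P_def)
    have sub: "sublinear r" "r x \<le> q x" if "r \<in> C" for r x
      using CA that by (auto simp: A_def le_fun_def)
    show "\<exists>u\<in>A. \<forall>a\<in>C. P a u"
    proof (cases "C = {}")
      case True
      then show ?thesis using q by (auto simp: A_def)
    next
      case False
      define u where "u x = (INF r\<in>C. r x)" for x
      have bdd: "bdd_below ((\<lambda>r. r x) ` C)" for x
      proof (rule bdd_belowI2[of _ "- q (- x)"])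
        fix r assume "r \<in> C"
        then show "- q (- x) \<le> r x"
          using sublinear_minus_ge[OF sub(1), of r x] sub(2)[of r "- x"] by simp
      qed
      have le: "u x \<le> r x" if "r \<in> C" for r x
        unfolding u_def using that by (intro cINF_lower bdd)
      have ge: "m \<le> u x" if "\<And>r. r \<in> C \<Longrightarrow> m \<le> r x" for m x
        unfolding u_def using that False by (intro cINF_greatest) auto
      have "sublinear u"
      proof (rule sublinearI)
        fix a b
        have "u (a + b) - r a \<le> s b" if "r \<in> C" "s \<in> C" for r s
        proof -
          obtain m where m: "m \<in> C" "m \<le> r" "m \<le> s" using chain \<open>r \<in> C\<close> \<open>s \<in> C\<close> by blast
          have "u (a + b) \<le> m a + m b"
            using le[OF m(1), of "a + b"] sublinear_add[OF sub(1)[OF m(1)], of a b] by simp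
          also have "\<dots> \<le> r a + s b" using m by (intro add_mono) (auto simp: le_fun_def)
          finally show ?thesis by simp
        qed
        then have "u (a + b) - u b \<le> r a" if "r \<in> C" for r
          using ge[of "u (a + b) - r a" b] that by fastforce
        then show "u (a + b) \<le> u a + u b"
          using ge[of "u (a + b) - u b" a] by fastforce
      next
        have "r 0 = 0" if "r \<in> C" for r using sublinear_0[OF sub(1)[OF that]] .
        then have "(\<lambda>r. r 0) ` C = {0}" using False by (auto intro: image_eqI[rotated])
        then show "u 0 = 0" by (simp add: u_def)
      next
        fix t :: real and x assume t: "t > 0"
        have "u (t *\<^sub>R x) / t \<le> r x" if "r \<in> C" for r
          using le[OF that, of "t *\<^sub>R x"] sublinear_scaleR[OF sub(1)[OF that], of t x] t
          by (simp add: field_simps)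
        then have "u (t *\<^sub>R x) / t \<le> u x" by (rule ge)
        then show "u (t *\<^sub>R x) \<le> t * u x" using t by (simp add: field_simps)
      qed
      moreover have "u \<le> q"
        using False le sub(2) by (fastforce simp: le_fun_def intro: order_trans)
      ultimately have "u \<in> A" by (simp add: A_def)
      then show ?thesis using le by (auto simp: P_def le_fun_def)
    qed
  qed
  then obtain m where m: "m \<in> A" "\<And>a. a \<in> A \<Longrightarrow> a \<le> m \<Longrightarrow> a = m"
    by (auto simp: P_def)
  show ?thesis
  proof
    show "sublinear m" "m \<le> q" using m(1) by (auto simp: A_def)
    show "s = m" if "sublinear s" "s \<le> m" for s
      using that m order_trans[of s m q] by (auto simp: A_def)
  qed
qed

lemma linear_of_odd_sublinear:
  assumes r: "sublinear r" and odd: "\<And>x. r (- x) = - r x"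
  shows "linear r"
proof (rule linearI)
  fix x y
  have "- r (x + y) \<le> - r x - r y"
    using sublinear_add[OF r, of "- x" "- y"] odd[of "x + y"] by (simp add: odd)
  then show "r (x + y) = r x + r y" using sublinear_add[OF r, of x y] by simp
next
  fix c :: real and x
  show "r (c *\<^sub>R x) = c *\<^sub>R r x"
  proof (cases "c \<ge> 0")
    case False
    then show ?thesis using sublinear_scaleR[OF r, of "- c" x] odd[of "c *\<^sub>R x"] by simp
  qed (simp add: sublinear_scaleR[OF r])
qed

text \<open>
  Lowering \<open>q\<close> in the direction \<open>y\<close> before passing to a minimal functional forces the
  value at \<open>- y\<close>; lowering the minimal functional once more in any direction changes nothing,
  hence it is odd.
\<close>

theorem linear_functional_below_sublinear:
  assumes q: "sublinear q"
  obtains g where "linear g" "\<And>x. g x \<le> q x" "g y = q y"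
proof -
  obtain q' where q': "sublinear q'" "q' \<le> q" "q' (- y) \<le> - q y"
    using sublinear_decrease[OF q] by blast
  obtain g where g: "sublinear g" "g \<le> q'" "\<And>s. sublinear s \<Longrightarrow> s \<le> g \<Longrightarrow> s = g"
    using minimal_sublinear_exists[OF q'(1)] by blast
  have odd: "g (- x) = - g x" for x
  proof -
    obtain s where "sublinear s" "s \<le> g" "s (- x) \<le> - g x"
      using sublinear_decrease[OF g(1)] by blast
    then have "g (- x) \<le> - g x" using g(3) by blast
    then show ?thesis using sublinear_minus_ge[OF g(1), of x] by simp
  qed
  have le: "g x \<le> q x" for x
    using g(2) q'(2) by (meson le_funD order_trans)
  have "- g y \<le> - q y"
    using odd[of y] le_funD[OF g(2), of "- y"] q'(3) by simp
  then have "g y = q y" using le[of y] by simp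
  then show ?thesis
    using that linear_of_odd_sublinear[OF g(1) odd] le by blast
qed

section \<open>Separation by the Minkowski functional\<close>

text \<open>
  The functional is the infimum of the \<open>t > 0\<close> with \<open>x \<in> t C\<close>. Convexity gives subadditivity,
  because \<open>(x + y) / (s + t)\<close> is a convex combination of \<open>x / s\<close> and \<open>y / t\<close>; off \<open>C\<close> no \<open>t < 1\<close>
  qualifies, because \<open>x\<close> would be a convex combination of \<open>x / t\<close> and \<open>0\<close>.
\<close>

lemma Minkowski_functional:
  fixes C :: "'a::real_vector set"
  assumes C: "convex C" "0 \<in> C"
    and absorbing: "\<And>x. \<exists>t>0. x /\<^sub>R t \<in> C"
  obtains q where "sublinear q" "\<And>x. x \<in> C \<Longrightarrow> q x \<le> 1" "\<And>x. x \<notin> C \<Longrightarrow> 1 \<le> q x"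
proof
  define G where "G x = {t. t > 0 \<and> x /\<^sub>R t \<in> C}" for x
  define q where "q x = Inf (G x)" for x
  have ne: "G x \<noteq> {}" for x using absorbing by (auto simp: G_def)
  have bdd: "bdd_below (G x)" for x by (rule bdd_belowI[of _ 0]) (simp add: G_def)
  have le: "q x \<le> t" if "t > 0" "x /\<^sub>R t \<in> C" for x t
    unfolding q_def using that by (intro cInf_lower bdd) (simp add: G_def)
  have ge: "m \<le> q x" if "\<And>t. t > 0 \<Longrightarrow> x /\<^sub>R t \<in> C \<Longrightarrow> m \<le> t" for m x
    unfolding q_def using that ne by (intro cInf_greatest) (auto simp: G_def)
  have cancel: "(s / u) *\<^sub>R (x /\<^sub>R s) = x /\<^sub>R u" if "s > 0" for s u :: real and x :: 'a
    using that by (simp add: divide_inverse_commute)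
  show "sublinear q"
  proof (rule sublinearI)
    fix x y
    have "q (x + y) - s \<le> t" if s: "s > 0" "x /\<^sub>R s \<in> C" and t: "t > 0" "y /\<^sub>R t \<in> C" for s t
    proof -
      have "(s / (s + t)) *\<^sub>R (x /\<^sub>R s) + (t / (s + t)) *\<^sub>R (y /\<^sub>R t) \<in> C"
        using s t by (intro convexD[OF C(1)]) (simp_all flip: add_divide_distrib)
      also have "(s / (s + t)) *\<^sub>R (x /\<^sub>R s) + (t / (s + t)) *\<^sub>R (y /\<^sub>R t) = (x + y) /\<^sub>R (s + t)"
        using s(1) t(1) cancel[of s "s + t" x] cancel[of t "s + t" y] by (simp only: scaleR_add_right)
      finally show ?thesis using le[of "s + t" "x + y"] s t by simp
    qed
    then have "q (x + y) - s \<le> q y" if "s > 0" "x /\<^sub>R s \<in> C" for s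
      using that by (intro ge) auto
    then have "q (x + y) - q y \<le> q x" by (intro ge) fastforce
    then show "q (x + y) \<le> q x + q y" by simp
  next
    have "q 0 \<le> 0"
    proof (rule field_le_epsilon)
      fix t :: real assume "t > 0"
      then show "q 0 \<le> 0 + t" using le[of t 0] C(2) by simp
    qed
    moreover have "0 \<le> q 0" by (intro ge) simp
    ultimately show "q 0 = 0" by (rule order_antisym)
  next
    fix t :: real and x assume t: "t > 0"
    have "q (t *\<^sub>R x) / t \<le> s" if "s > 0" "x /\<^sub>R s \<in> C" for s
    proof -
      have eq: "(t *\<^sub>R x) /\<^sub>R (t * s) = x /\<^sub>R s" using t that(1) by (simp add: field_simps)
      have "q (t *\<^sub>R x) \<le> t * s" using t that by (intro le) (simp_all only: eq mult_pos_pos)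
      then show ?thesis using t by (simp add: field_simps)
    qed
    then have "q (t *\<^sub>R x) / t \<le> q x" by (rule ge)
    then show "q (t *\<^sub>R x) \<le> t * q x" using t by (simp add: field_simps)
  qed
  show "q x \<le> 1" if "x \<in> C" for x using le[of 1 x] that by simp
  show "1 \<le> q x" if "x \<notin> C" for x
  proof (rule ge, rule ccontr)
    fix t :: real assume t: "t > 0" "x /\<^sub>R t \<in> C" "\<not> 1 \<le> t"
    then have "t *\<^sub>R (x /\<^sub>R t) + (1 - t) *\<^sub>R 0 \<in> C"
      by (intro convexD[OF C(1)]) (auto simp: C(2))
    with t that show False by simp
  qed
qed

context locally_convex_space
begin

text \<open>
  A real-linear \<open>g\<close> is the real part of the \<open>\<complex>\<close>-linear functional \<open>g x - \<i> g (\<i> x)\<close>. The scalar \<open>j\<close>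
  is \<open>\<i>\<close> in the complex case; over the reals \<open>f = g\<close> and \<open>j = 0\<close> will do. It is chosen
  before \<open>g\<close> so that one neighbourhood of \<open>0\<close> can control all \<open>f\<close> at once.
\<close>

lemma scalar_functional_of_real_functional:
  obtains j where "\<And>g. linear g \<Longrightarrow>
    \<exists>f. Vector_Spaces.linear scale (*) f \<and>
        (\<forall>x. \<bar>g x\<bar> \<le> norm (f x) \<and> norm (f x) \<le> \<bar>g x\<bar> + \<bar>g (scale j x)\<bar>)"
proof -
  have scaleR: "scale (a *\<^sub>R 1) x = a *\<^sub>R x" for a x
    using scale_of_real[of a x] by (simp add: of_real_def)
  have linearI': "Vector_Spaces.linear scale (*) f"
    if "\<And>x y. f (x + y) = f x + f y" "\<And>c x. f (scale c x) = c * f x" for f :: "'a \<Rightarrow> 'k"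
    using that by unfold_locales (auto simp: algebra_simps)
  consider (real) "\<forall>z :: 'k. \<exists>a. z = a *\<^sub>R 1"
    | (complex) i :: 'k where "i * i = - 1"
        "\<forall>z. \<exists>a b. z = a *\<^sub>R 1 + b *\<^sub>R i \<and> norm z = sqrt (a\<^sup>2 + b\<^sup>2)"
    using real_or_complex by blast
  then show ?thesis
  proof cases
    case real
    show ?thesis
    proof (rule that[of 0])
      fix g :: "'a \<Rightarrow> real" assume g: "linear g"
      have "Vector_Spaces.linear scale (*) (\<lambda>x. of_real (g x) :: 'k)"
      proof (rule linearI')
        fix c :: 'k and x
        obtain a where "c = a *\<^sub>R 1" using real by blast
        then show "of_real (g (scale c x)) = c * of_real (g x)"
          using scaleR by (simp add: linear_scale[OF g] scaleR_conv_of_real)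
      qed (simp add: linear_add[OF g])
      then show "\<exists>f. Vector_Spaces.linear scale (*) f \<and>
        (\<forall>x. \<bar>g x\<bar> \<le> norm (f x) \<and> norm (f x) \<le> \<bar>g x\<bar> + \<bar>g (scale 0 x)\<bar>)"
        by (intro exI[of _ "\<lambda>x. of_real (g x)"]) simp
    qed
  next
    case (complex i)
    have norm_eq: "norm (of_real a + of_real b * i) = sqrt (a\<^sup>2 + b\<^sup>2)" for a b
    proof -
      \<comment> \<open>The coordinates for which the modulus formula is known are the given ones: \<open>1\<close> and \<open>i\<close>
          are independent, as otherwise \<open>i\<close> would be a real square root of \<open>- 1\<close>.\<close>
      obtain c d where cd: "of_real a + of_real b * i = c *\<^sub>R 1 + d *\<^sub>R i"
        "norm (of_real a + of_real b * i) = sqrt (c\<^sup>2 + d\<^sup>2)"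
        using complex(2) by blast
      have eq: "of_real (a - c) = of_real (d - b) * i"
        using cd(1) by (simp add: algebra_simps scaleR_conv_of_real)
      have "of_real ((a - c)\<^sup>2) = (of_real (a - c) :: 'k) * of_real (a - c)"
        by (simp add: power2_eq_square)
      also have "\<dots> = of_real ((d - b)\<^sup>2) * (i * i)"
        unfolding eq by (simp add: power2_eq_square algebra_simps)
      also have "\<dots> = of_real (- (d - b)\<^sup>2)" using complex(1) by simp
      finally have "(a - c)\<^sup>2 = - (d - b)\<^sup>2" by (simp only: of_real_eq_iff)
      then have "(a - c)\<^sup>2 + (d - b)\<^sup>2 = 0" by simp
      then have "a = c" "d = b" by (simp_all only: sum_power2_eq_zero_iff) simp_all
      then show ?thesis using cd(2) by simp
    qed
    show ?thesis
    proof (rule that[of i])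
      fix g :: "'a \<Rightarrow> real" assume g: "linear g"
      define f where "f x = of_real (g x) - of_real (g (scale i x)) * i" for x
      have f_eq: "f x = of_real (g x) + of_real (- g (scale i x)) * i" for x
        by (simp add: f_def)
      have f_add: "f (x + y) = f x + f y" for x y
        by (simp add: f_def scale_right_distrib linear_add[OF g] algebra_simps)
      have f_scaleR: "f (a *\<^sub>R x) = of_real a * f x" for a x
      proof -
        have "scale i (a *\<^sub>R x) = a *\<^sub>R scale i x"
          by (simp flip: scale_of_real add: mult.commute)
        then show ?thesis by (simp add: f_def linear_scale[OF g] algebra_simps)
      qed
      have ii: "scale i (scale i x) = - x" for x
        using complex(1) by simp
      have f_i: "f (scale i x) = i * f x" for x
      proof -
        have "i * f x = of_real (g x) * i - of_real (g (scale i x)) * (i * i)"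
          by (simp add: f_def algebra_simps)
        also have "\<dots> = f (scale i x)"
          using complex(1) by (simp add: f_def ii linear_neg[OF g])
        finally show ?thesis by simp
      qed
      have "Vector_Spaces.linear scale (*) f"
      proof (rule linearI'[OF f_add])
        fix c x
        obtain a b where c: "c = a *\<^sub>R 1 + b *\<^sub>R i" using complex(2) by blast
        then have "c = of_real a + of_real b * i" by (simp add: scaleR_conv_of_real)
        moreover from this have "scale c x = a *\<^sub>R x + b *\<^sub>R scale i x"
          by (simp add: scale_left_distrib flip: scale_of_real)
        ultimately show "f (scale c x) = c * f x"
          by (simp add: f_add f_scaleR f_i algebra_simps)
      qed
      moreover have "\<bar>g x\<bar> \<le> norm (f x)" for x
        unfolding f_eq norm_eq by (rule real_sqrt_ge_abs1)
      moreover have "norm (f x) \<le> \<bar>g x\<bar> + \<bar>g (scale i x)\<bar>" for x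
        unfolding f_eq norm_eq using sqrt_sum_squares_le_sum_abs[of "g x" "- g (scale i x)"] by simp
      ultimately show "\<exists>f. Vector_Spaces.linear scale (*) f \<and>
        (\<forall>x. \<bar>g x\<bar> \<le> norm (f x) \<and> norm (f x) \<le> \<bar>g x\<bar> + \<bar>g (scale i x)\<bar>)"
        by blast
    qed
  qed
qed

lemma continuous_on_scale [continuous_intros]:
  assumes "continuous_on S u" "continuous_on S v"
  shows "continuous_on S (\<lambda>x. scale (u x) (v x))"
  using continuous_on_compose2[OF continuous_scale continuous_on_Pair[OF assms]] by simp

text \<open>A neighbourhood of \<open>0\<close> absorbs each point, by continuity of \<open>c \<mapsto> c x\<close> at \<open>0\<close>.\<close>

lemma small_multiples_in_neighbourhood:
  assumes "open U" "0 \<in> U"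
  obtains d where "d > 0" "\<And>c. norm c < d \<Longrightarrow> scale c x \<in> U"
proof -
  have "open ((\<lambda>c. scale c x) -` U)"
    by (intro open_vimage assms continuous_intros)
  moreover have "0 \<in> (\<lambda>c. scale c x) -` U" using assms by simp
  ultimately obtain d where "d > 0" "ball 0 d \<subseteq> (\<lambda>c. scale c x) -` U"
    by (meson open_contains_ball)
  then show ?thesis by (intro that[of d]) (auto simp: subset_iff)
qed

lemma tvs_bounded_singleton: "tvs_bounded scale euclidean {x}"
  unfolding tvs_bounded_def
proof (intro conjI allI impI)
  fix U :: "'a set" assume "openin euclidean U \<and> 0 \<in> U"
  then obtain d where d: "d > 0" "\<And>c. norm c < d \<Longrightarrow> scale c x \<in> U"
    using small_multiples_in_neighbourhood[of U x] by auto
  have "{x} \<subseteq> scale c ` U" if c: "2 / d \<le> norm c" for c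
  proof -
    have "0 < 2 / d" using d by simp
    then have pos: "norm c > 0" using c by linarith
    have "2 \<le> d * norm c" using c d(1) by (simp add: field_simps)
    then have "inverse (norm c) < d" using pos by (simp add: field_simps)
    then have "norm (inverse c) < d" by (simp add: norm_inverse)
    then have "scale (inverse c) x \<in> U" by (rule d)
    moreover have "x = scale c (scale (inverse c) x)" using pos by simp
    ultimately show ?thesis by blast
  qed
  then show "\<exists>r>0. \<forall>c. r \<le> norm c \<longrightarrow> {x} \<subseteq> scale c ` U"
    using d(1) by (intro exI[of _ "2 / d"]) simp
qed simp

lemma linear_in_dual_if_bounded_near_0:
  assumes f: "Vector_Spaces.linear scale (*) f"
    and U: "open U" "0 \<in> U" "\<And>x. x \<in> U \<Longrightarrow> norm (f x) \<le> K"
  shows "f \<in> dual scale"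
proof -
  interpret f: Vector_Spaces.linear scale "(*)" f by (rule f)
  have K: "K \<ge> 0" using U(3)[OF U(2)] norm_ge_zero order_trans by blast
  have near: "\<exists>V. open V \<and> x \<in> V \<and> (\<forall>y\<in>V. dist (f y) (f x) < e)" if e: "e > 0" for x e
  proof (intro exI conjI ballI)
    \<comment> \<open>If \<open>t (y - x) \<in> U\<close> then \<open>t\<close> times the increment of \<open>f\<close> is at most \<open>K\<close>, and \<open>K < t e\<close>.\<close>
    define t where "t = (K + 1) / e"
    have t: "t > 0" using e K by (simp add: t_def)
    let ?V = "(\<lambda>y. scale (of_real t) (y - x)) -` U"
    show "open ?V" by (intro open_vimage U continuous_intros)
    show "x \<in> ?V" using U by simp
    fix y assume "y \<in> ?V"
    then have "norm (f (scale (of_real t) (y - x))) \<le> K" by (intro U) simp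
    then have "t * norm (f y - f x) \<le> K"
      using t by (simp add: f.scale f.diff norm_mult)
    also have "K < t * e" using e by (simp add: t_def)
    finally show "dist (f y) (f x) < e" using t by (simp add: dist_norm)
  qed
  have "continuous_on UNIV f"
    unfolding continuous_on_def
  proof (intro ballI tendstoI)
    fix x and e :: real assume "0 < e"
    then show "\<forall>\<^sub>F y in at x within UNIV. dist (f y) (f x) < e"
      using near[of e x] unfolding eventually_at_topological by blast
  qed
  then show ?thesis using f by (simp add: dual_def operator_def)
qed

section \<open>Polars\<close>

text \<open>
  Apply Hahn--Banach to the Minkowski functional of a convex neighbourhood \<open>C \<subseteq> W\<close>, and let \<open>U\<close>
  consist of the \<open>x\<close> for which \<open>\<plusminus> x\<close> and \<open>\<plusminus> j x\<close> lie in \<open>C\<close>. The bound \<open>2\<close> comes from the passage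
  from a real functional \<open>g\<close> to a scalar one: on \<open>U\<close>, both \<open>\<bar>g x\<bar>\<close> and \<open>\<bar>g (j x)\<bar>\<close> are at most \<open>1\<close>.
\<close>

lemma polar_separates:
  assumes W: "open W" "0 \<in> W"
  obtains U where "open U" "0 \<in> U"
    "\<And>y. y \<notin> W \<Longrightarrow> \<exists>f\<in>dual scale. (\<forall>x\<in>U. norm (f x) \<le> 2) \<and> 1 \<le> norm (f y)"
proof -
  obtain C where C: "open C" "convex C" "0 \<in> C" "C \<subseteq> W"
    using locally_convex[OF W] by blast
  obtain j where j: "\<And>g. linear g \<Longrightarrow>
    \<exists>f. Vector_Spaces.linear scale (*) f \<and>
        (\<forall>x. \<bar>g x\<bar> \<le> norm (f x) \<and> norm (f x) \<le> \<bar>g x\<bar> + \<bar>g (scale j x)\<bar>)"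
    using scalar_functional_of_real_functional by blast
  have "\<exists>t>0. x /\<^sub>R t \<in> C" for x
  proof -
    obtain d where d: "d > 0" "\<And>c. norm c < d \<Longrightarrow> scale c x \<in> C"
      using small_multiples_in_neighbourhood[OF C(1,3)] by blast
    have "x /\<^sub>R (2 / d) \<in> C"
      using d(2)[of "of_real (d / 2)"] d(1) unfolding scale_of_real by simp
    then show ?thesis using d(1) by (intro exI[of _ "2 / d"]) simp
  qed
  then obtain q where q: "sublinear q" "\<And>x. x \<in> C \<Longrightarrow> q x \<le> 1" "\<And>x. x \<notin> C \<Longrightarrow> 1 \<le> q x"
    using Minkowski_functional[OF C(2,3)] by blast
  define S where "S = C \<inter> uminus -` C"
  define U where "U = S \<inter> scale j -` S"
  have S: "open S" "0 \<in> S"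
    unfolding S_def using C by (auto intro!: open_Int open_vimage continuous_intros)
  have U: "open U" "0 \<in> U"
    unfolding U_def using S by (auto intro!: open_Int open_vimage continuous_intros)
  have "\<exists>f\<in>dual scale. (\<forall>x\<in>U. norm (f x) \<le> 2) \<and> 1 \<le> norm (f y)" if "y \<notin> W" for y
  proof -
    obtain g where g: "linear g" "\<And>x. g x \<le> q x" "g y = q y"
      using linear_functional_below_sublinear[OF q(1)] by blast
    obtain f where f: "Vector_Spaces.linear scale (*) f"
      "\<And>x. \<bar>g x\<bar> \<le> norm (f x)" "\<And>x. norm (f x) \<le> \<bar>g x\<bar> + \<bar>g (scale j x)\<bar>"
      using j[OF g(1)] by blast
    have gS: "\<bar>g x\<bar> \<le> 1" if "x \<in> S" for x
      using that g(2)[of x] g(2)[of "- x"] q(2)[of x] q(2)[of "- x"] linear_neg[OF g(1), of x]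
      by (auto simp: S_def)
    have fU: "norm (f x) \<le> 2" if "x \<in> U" for x
      using f(3)[of x] gS[of x] gS[of "scale j x"] that by (auto simp: U_def)
    have "1 \<le> q y" using q(3) \<open>y \<notin> W\<close> C(4) by blast
    then have "1 \<le> norm (f y)" using f(2)[of y] g(3) by linarith
    moreover have "f \<in> dual scale"
      using linear_in_dual_if_bounded_near_0[OF f(1) U fU] .
    ultimately show ?thesis using fU by blast
  qed
  with U show ?thesis by (rule that)
qed

lemma dual_scale_mem_dual:
  assumes "f \<in> dual scale"
  shows "dual_scale c f \<in> dual scale"
proof -
  interpret f: Vector_Spaces.linear scale "(*)" f
    using assms by (simp add: dual_def operator_def)
  have "Vector_Spaces.linear scale (*) (dual_scale c f)"
    by unfold_locales (simp_all add: dual_scale_def f.add f.scale algebra_simps)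
  moreover have "continuous_on UNIV (dual_scale c f)"
    using assms unfolding dual_scale_def dual_def operator_def by (auto intro!: continuous_intros)
  ultimately show ?thesis by (simp add: dual_def operator_def)
qed

text \<open>
  A bounded set \<open>A\<close> lies in some \<open>r U\<close>, so the functionals in the polar of \<open>U\<close> are uniformly bounded on
  \<open>A\<close>; this is boundedness in the topology of uniform convergence on bounded sets.
\<close>

lemma strongly_bounded_polar:
  assumes U: "open U" "0 \<in> U"
  shows "tvs_bounded dual_scale (strong_topology scale)
    {f \<in> dual scale. \<forall>x\<in>U. norm (f x) \<le> K}" (is "tvs_bounded _ _ ?B")
  unfolding tvs_bounded_def
proof (intro conjI allI impI)
  show "?B \<subseteq> topspace (strong_topology scale)"
    by (auto simp: topspace_strong_topology)
  fix W :: "('a \<Rightarrow> 'k) set" assume "openin (strong_topology scale) W \<and> 0 \<in> W"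
  then obtain A e where A: "tvs_bounded scale euclidean A" and e: "e > 0"
    and W: "{g \<in> dual scale. \<forall>x\<in>A. norm (g x) < e} \<subseteq> W"
    by (fastforce simp: openin_strong_topology strong_open_def)
  obtain r where r: "r > 0" "\<And>c. r \<le> norm c \<Longrightarrow> A \<subseteq> scale c ` U"
    using A U unfolding tvs_bounded_def by auto
  have bound: "norm (f x) \<le> r * \<bar>K\<bar>" if f: "f \<in> ?B" and x: "x \<in> A" for f x
  proof -
    interpret f: Vector_Spaces.linear scale "(*)" f
      using f by (simp add: dual_def operator_def)
    obtain u where u: "u \<in> U" "x = scale (of_real r) u"
      using r(2)[of "of_real r"] r(1) x by auto
    have "norm (f u) \<le> \<bar>K\<bar>" using f u(1) by fastforce
    then show ?thesis using r(1) by (simp add: u(2) f.scale norm_mult)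
  qed
  \<comment> \<open>The summand \<open>1\<close> makes the estimate on \<open>A\<close> strict.\<close>
  define R where "R = r * \<bar>K\<bar> / e + 1"
  have R: "R > 0" using r(1) e by (simp add: R_def add_nonneg_pos)
  have "?B \<subseteq> dual_scale c ` W" if c: "R \<le> norm c" for c
  proof
    fix f assume f: "f \<in> ?B"
    have c0: "norm c > 0" using R c by linarith
    have "norm (dual_scale (inverse c) f x) < e" if "x \<in> A" for x
    proof -
      have "norm (f x) \<le> r * \<bar>K\<bar>" using bound f that .
      also have "\<dots> < R * e" using e by (simp add: R_def algebra_simps)
      also have "\<dots> \<le> norm c * e" using c e by simp
      finally show ?thesis
        using c0 unfolding dual_scale_def norm_mult norm_inverse by (simp add: field_simps)
    qed
    then have "dual_scale (inverse c) f \<in> W"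
      using W f dual_scale_mem_dual by blast
    moreover have "f = dual_scale c (dual_scale (inverse c) f)"
      using c0 by (simp add: dual_scale_def fun_eq_iff)
    ultimately show "f \<in> dual_scale c ` W" by blast
  qed
  with R show "\<exists>r>0. \<forall>c. r \<le> norm c \<longrightarrow> ?B \<subseteq> dual_scale c ` W" by blast
qed

text \<open>Points are bounded sets, so evaluation at a point is continuous in the strong topology.\<close>

lemma openin_strong_of_openin_weak_star:
  assumes "openin (weak_star scale) W"
  shows "openin (strong_topology scale) W"
proof -
  have "continuous_map (strong_topology scale) euclidean (\<lambda>f. f x)" for x
    unfolding continuous_map_def topspace_strong_topology openin_strong_topology
  proof (intro conjI allI impI)
    fix V :: "'k set" assume "openin euclidean V"
    then have V: "open V" by simp
    show "strong_open scale {f \<in> dual scale. f x \<in> V}"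
      unfolding strong_open_def
    proof (intro conjI ballI)
      fix f assume "f \<in> {f \<in> dual scale. f x \<in> V}"
      then obtain e where "e > 0" "ball (f x) e \<subseteq> V"
        using V by (auto simp: open_contains_ball)
      then have "{g \<in> dual scale. \<forall>y\<in>{x}. norm (g y - f y) < e} \<subseteq> {f \<in> dual scale. f x \<in> V}"
        by (auto simp: subset_iff dist_norm norm_minus_commute)
      with \<open>e > 0\<close> show "\<exists>A e. tvs_bounded scale euclidean A \<and> e > 0 \<and>
          {g \<in> dual scale. \<forall>x\<in>A. norm (g x - f x) < e} \<subseteq> {f \<in> dual scale. f x \<in> V}"
        using tvs_bounded_singleton[of x] by blast
    qed auto
  qed simp
  then have "continuous_map (strong_topology scale) (weak_star scale) (\<lambda>f. f)"
    unfolding weak_star_def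
    by (auto simp: continuous_map_in_subtopology continuous_map_componentwise_UNIV
        topspace_strong_topology)
  then have "openin (strong_topology scale) {f \<in> topspace (strong_topology scale). f \<in> W}"
    using assms by (rule openin_continuous_map_preimage)
  moreover have "W \<subseteq> dual scale"
    using openin_subset[OF assms] by (simp add: topspace_weak_star)
  ultimately show ?thesis
    by (simp add: topspace_strong_topology Collect_conj_eq Int_absorb1)
qed

lemma weak_star_bounded_of_strongly_bounded:
  assumes "tvs_bounded dual_scale (strong_topology scale) B"
  shows "tvs_bounded dual_scale (weak_star scale) B"
  using assms openin_strong_of_openin_weak_star
  unfolding tvs_bounded_def topspace_strong_topology topspace_weak_star by blast

end

section \<open>Adjoints and \<open>p\<close>-convergence\<close>

lemma adjoint_op_mem_dual:
  assumes "operator sE sL T" "f \<in> dual sL"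
  shows "adjoint_op T f \<in> dual sE"
  using assms Vector_Spaces.linear_compose[of sE sL T "(*)" f]
    continuous_on_compose[of UNIV T f] continuous_on_subset[of UNIV f "range T"]
  by (auto simp: dual_def operator_def adjoint_op_def)

lemma V_set_adjoint_of_equicontinuous:
  assumes T: "operator sE sL T"
    and conv: "p_convergent p sE T"
    and B: "B \<noteq> {}" "B \<subseteq> dual sL" "equicontinuous B"
  shows "V_set p sE (adjoint_op T ` B)"
  unfolding V_set_def
proof (intro conjI allI impI)
  show "adjoint_op T ` B \<noteq> {}" using B by simp
  show "adjoint_op T ` B \<subseteq> dual sE" using B adjoint_op_mem_dual[OF T] by blast
  fix x assume "weakly_summable p sE x"
  then have lim: "(\<lambda>n. T (x n)) \<longlonglongrightarrow> 0" using conv by (simp add: p_convergent_def)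
  have f0: "f 0 = 0" if "f \<in> B" for f
  proof -
    interpret f: Vector_Spaces.linear sL "(*)" f
      using that B(2) by (auto simp: dual_def operator_def)
    show ?thesis by (rule f.zero)
  qed
  show "(\<lambda>n. SUP f\<in>adjoint_op T ` B. ennreal (norm (f (x n)))) \<longlonglongrightarrow> 0"
  proof (rule order_tendstoI)
    fix a :: ennreal assume "0 < a"
    then obtain b where b: "0 < b" "b < a" using dense by blast
    then obtain e where e: "b = ennreal e" "e > 0"
      by (cases b) (auto simp: ennreal_less_zero_iff)
    obtain U where U: "open U" "0 \<in> U" "\<And>f y. f \<in> B \<Longrightarrow> y \<in> U \<Longrightarrow> norm (f y) < e"
      using B(3) e(2) f0 unfolding equicontinuous_def by (metis diff_zero)
    from topological_tendstoD[OF lim U(1,2)]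
    show "\<forall>\<^sub>F n in sequentially. (SUP f\<in>adjoint_op T ` B. ennreal (norm (f (x n)))) < a"
    proof eventually_elim
      case (elim n)
      have "(SUP f\<in>adjoint_op T ` B. ennreal (norm (f (x n)))) \<le> b"
      proof (rule SUP_least)
        fix h assume "h \<in> adjoint_op T ` B"
        then obtain f where "f \<in> B" "h = adjoint_op T f" by blast
        with U(3)[OF _ elim] show "ennreal (norm (h (x n))) \<le> b"
          by (simp add: e(1) adjoint_op_def ennreal_leI less_imp_le)
      qed
      then show ?case using b by simp
    qed
  qed simp
qed

lemma p_convergent_of_adjoint_V_sets:
  fixes sL :: "'k::real_or_complex \<Rightarrow> 'b \<Rightarrow> 'b::{real_vector, topological_ab_group_add, t2_space}"
    and T :: "'a::{ab_group_add, topological_space} \<Rightarrow> 'b"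
  assumes L: "locally_convex_space sL"
    and V: "\<And>B. B \<noteq> {} \<Longrightarrow> tvs_bounded dual_scale (strong_topology sL) B
      \<Longrightarrow> V_set p sE (adjoint_op T ` B)"
  shows "p_convergent p sE T"
  unfolding p_convergent_def
proof (intro allI impI topological_tendstoI)
  fix x :: "nat \<Rightarrow> 'a" and W :: "'b set"
  assume x: "weakly_summable p sE x" and W: "open W" "0 \<in> W"
  obtain U where U: "open U" "0 \<in> U"
    "\<And>y. y \<notin> W \<Longrightarrow> \<exists>f\<in>dual sL. (\<forall>x\<in>U. norm (f x) \<le> 2) \<and> 1 \<le> norm (f y)"
    using locally_convex_space.polar_separates[OF L W] by blast
  define B where "B = {f \<in> dual sL. \<forall>x\<in>U. norm (f x) \<le> 2}"
  have bdd: "tvs_bounded dual_scale (strong_topology sL) B"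
    unfolding B_def using locally_convex_space.strongly_bounded_polar[OF L U(1,2)] .
  show "\<forall>\<^sub>F n in sequentially. T (x n) \<in> W"
  proof (cases "B = {}")
    case True
    then have "y \<in> W" for y using U(3)[of y] by (auto simp: B_def)
    then show ?thesis by simp
  next
    case False
    then have "(\<lambda>n. SUP f\<in>adjoint_op T ` B. ennreal (norm (f (x n)))) \<longlonglongrightarrow> 0"
      using V[OF False bdd] x by (simp add: V_set_def)
    then have "\<forall>\<^sub>F n in sequentially. (SUP f\<in>adjoint_op T ` B. ennreal (norm (f (x n)))) < 1"
      by (rule order_tendstoD) simp
    then show ?thesis
    proof eventually_elim
      case (elim n)
      show ?case
      proof (rule ccontr)
        assume "T (x n) \<notin> W"
        then obtain f where f: "f \<in> B" "1 \<le> norm (f (T (x n)))"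
          using U(3) by (auto simp: B_def)
        then have "1 \<le> ennreal (norm (adjoint_op T f (x n)))"
          by (simp add: adjoint_op_def)
        also have "\<dots> \<le> (SUP f\<in>adjoint_op T ` B. ennreal (norm (f (x n))))"
          using f(1) by (intro SUP_upper) simp
        finally show False using elim by simp
      qed
    qed
  qed
qed

theorem theorem14p6:
  fixes p :: ennreal
    and sE :: "'k::real_or_complex \<Rightarrow> 'a \<Rightarrow> 'a::{real_vector, topological_ab_group_add, t2_space}"
    and sL :: "'k \<Rightarrow> 'b \<Rightarrow> 'b::{real_vector, topological_ab_group_add, t2_space}"
    and T :: "'a \<Rightarrow> 'b"
  assumes "1 \<le> p"
    and "locally_convex_space sE"
    and "locally_convex_space sL"
    and "operator sE sL T"
  shows
    "((\<forall>B. B \<noteq> {} \<and> tvs_bounded dual_scale (strong_topology sL) B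
          \<longrightarrow> V_set p sE (adjoint_op T ` B))
        \<longrightarrow> p_convergent p sE T) \<and>
     (quasibarrelled sL \<longrightarrow> p_convergent p sE T \<longrightarrow>
        (\<forall>B. B \<noteq> {} \<and> tvs_bounded dual_scale (strong_topology sL) B
          \<longrightarrow> V_set p sE (adjoint_op T ` B))) \<and>
     ((\<forall>B. B \<noteq> {} \<and> tvs_bounded dual_scale (weak_star sL) B
          \<longrightarrow> V_set p sE (adjoint_op T ` B))
        \<longrightarrow> p_convergent p sE T) \<and>
     (barrelled sL \<longrightarrow> p_convergent p sE T \<longrightarrow>
        (\<forall>B. B \<noteq> {} \<and> tvs_bounded dual_scale (weak_star sL) B
          \<longrightarrow> V_set p sE (adjoint_op T ` B)))"
proof (intro conjI impI allI)
  assume "\<forall>B. B \<noteq> {} \<and> tvs_bounded dual_scale (strong_topology sL) B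
    \<longrightarrow> V_set p sE (adjoint_op T ` B)"
  then show "p_convergent p sE T"
    by (intro p_convergent_of_adjoint_V_sets[OF assms(3)]) blast
next
  assume "\<forall>B. B \<noteq> {} \<and> tvs_bounded dual_scale (weak_star sL) B
    \<longrightarrow> V_set p sE (adjoint_op T ` B)"
  then show "p_convergent p sE T"
    using locally_convex_space.weak_star_bounded_of_strongly_bounded[OF assms(3)]
    by (intro p_convergent_of_adjoint_V_sets[OF assms(3)]) blast
next
  fix B assume "quasibarrelled sL" "p_convergent p sE T"
    "B \<noteq> {} \<and> tvs_bounded dual_scale (strong_topology sL) B"
  then show "V_set p sE (adjoint_op T ` B)"
    using V_set_adjoint_of_equicontinuous[OF assms(4)]
    by (auto simp: quasibarrelled_def tvs_bounded_def topspace_strong_topology)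
next
  fix B assume "barrelled sL" "p_convergent p sE T"
    "B \<noteq> {} \<and> tvs_bounded dual_scale (weak_star sL) B"
  then show "V_set p sE (adjoint_op T ` B)"
    using V_set_adjoint_of_equicontinuous[OF assms(4)]
    by (auto simp: barrelled_def tvs_bounded_def topspace_weak_star)
qed

end
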